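(* Consider financial network games under priority-proportional strategies (non-negative external assets, debt contracts only) with default costs $(\alpha,\beta)$, where $\alpha,\beta\in[0,1]$, in which firms aim to maximize their equity. For fixed $(\alpha,\beta)$ the price of anarchy is: (i) equal to $1$ when $\alpha=\beta=0$; (ii) unbounded (for every $R>0$ there is an instance with price of anarchy at least $R$) when $\beta\in(0,1)$, or $\beta=0$ and $\alpha\in(0,1]$, or $\beta=1$ and $\alpha=0$; (iii) at least $1/\alpha-\varepsilon$ for any $\varepsilon>0$, when $\beta=1$ and $\alpha\in(0,1)$.
   Context: Financial network: firms $v_1,\dots,v_n$; each $v_i$ has external assets $e_i\ge 0$; $v_i$ owes $v_j$ the liability $l_{ij}\ge 0$, with $l_{ii}=0$ (both $l_{ij}>0$ and $l_{ji}>0$ are allowed); $L_i=\sum_j l_{ij}$. Default costs $\alpha,\beta\in[0,1]$: a firm in default can use only an $\alpha$ fraction of its external assets and a $\beta$ fraction of its incoming payments. Priority-proportional strategy: a strategy $s_i$ of $v_i$ is a complete ordering, allowing ties, of its creditors, i.e. an ordered partition of $\{v_j: l_{ij}>0\}$ into priority classes $1,2,\dots$. Write $L_i^{(m)}$ for the total liability of $v_i$ to its $m$-th class, $k_{ij}$ for the index of the class of $v_i$ containing $v_j$, and $\pi'_{ij}=l_{ij}/L_i^{(k_{ij})}$. Clearing payments consistent with a strategy profile $\mathbf{s}=(s_1,\dots,s_n)$: a matrix $\mathbf{P}=(p_{ij})$ with $p_{ii}=0$, $0\le p_{ij}\le l_{ij}$ and, writing $p_i=\sum_j p_{ij}$,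 for every $i$: $p_i=L_i$ if $L_i\le e_i+\sum_j p_{ji}$ (solvent), and $p_i=\alpha e_i+\beta\sum_j p_{ji}$ otherwise (in default); moreover for every creditor $v_j$ of $v_i$, $$p_{ij}=\min\Big\{\max\Big\{\Big(p_i-\sum_{m=1}^{k_{ij}-1}L_i^{(m)}\Big)\pi'_{ij},\,0\Big\},\,l_{ij}\Big\},$$ and $p_{ij}=0$ if $l_{ij}=0$. Clearing payments are proper if every firm with a positive outgoing payment is reachable, by a (possibly trivial) directed path of edges $(v_i,v_j)$ with $p_{ij}>0$, from some firm with positive external assets. Only proper clearing payments are considered. For every profile $\mathbf{s}$ there are maximal ones, denoted $\mathbf{P}(\mathbf{s})$, which are entrywise at least as large as all other proper clearing payments consistent with $\mathbf{s}$. Equity: $E_i(\mathbf{P})=\max\{0,\ e_i+\sum_j p_{ji}-L_i\}$. The utility of $v_i$ under $\mathbf{s}$ is $E_i(\mathbf{P}(\mathbf{s}))$. A profile is a (pure) Nash equilibrium if no firm can strictly increase its utility by unilaterally changing its priority-proportional strategy. Social welfare: $SW(\mathbf{P})=\sum_i E_i(\mathbf{P})$; $OPT$ is the maximum of $SW(\mathbf{P}(\mathbf{s}))$ over all strategy profiles. The price of anarchy of an instance is the maximum of $OPT/SW(\mathbf{P}(\mathbf{s}))$ over Nash equilibria $\mathbf{s}$ (with $0/0=1$ and $x/0=+\infty$ for $x>0$); that of a class of games is the supremum over its instances. *)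

theory Defs
  imports Complex_Main "HOL-Library.Extended_Real" "HOL-Library.Disjoint_Sets"
begin

text \<open>
  The firms of a network are \<open>0, \<dots>, nfirms G - 1\<close>. The values of \<open>assets\<close> and \<open>liab\<close>
  at indices outside this range are never used.
\<close>

record network =
  nfirms :: nat
  assets :: "nat \<Rightarrow> real"
  liab :: "nat \<Rightarrow> nat \<Rightarrow> real"

definition valid_network :: "network \<Rightarrow> bool" where
  "valid_network G \<longleftrightarrow> 0 < nfirms G
     \<and> (\<forall>i<nfirms G. 0 \<le> assets G i)
     \<and> (\<forall>i<nfirms G. \<forall>j<nfirms G. 0 \<le> liab G i j)
     \<and> (\<forall>i<nfirms G. liab G i i = 0)"

definition creditors :: "network \<Rightarrow> nat \<Rightarrow> nat set" where
  "creditors G i = {j. j < nfirms G \<and> 0 < liab G i j}"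

definition total_liab :: "network \<Rightarrow> nat \<Rightarrow> real" where
  "total_liab G i = (\<Sum>j<nfirms G. liab G i j)"

text \<open>
  A priority-proportional strategy is an ordered partition of the creditors, given as the list of
  its classes. List positions start at 0, so position \<open>m\<close> holds the class of priority \<open>m + 1\<close>.
\<close>

type_synonym strategy = "nat set list"

type_synonym profile = "nat \<Rightarrow> strategy"

definition strategies :: "network \<Rightarrow> nat \<Rightarrow> strategy set" where
  "strategies G i = {C. distinct C \<and> partition_on (creditors G i) (set C)}"

text \<open>The value \<open>[]\<close> outside the range of firms only serves to make the set of profiles finite.\<close>

definition profiles :: "network \<Rightarrow> profile set" where
  "profiles G = {s. (\<forall>i<nfirms G. s i \<in> strategies G i) \<and> (\<forall>i\<ge>nfirms G. s i = [])}"

definition class_liab :: "network \<Rightarrow> profile \<Rightarrow> nat \<Rightarrow> nat \<Rightarrow> real" where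
  "class_liab G s i m = (\<Sum>j\<in>s i ! m. liab G i j)"

definition class_idx :: "profile \<Rightarrow> nat \<Rightarrow> nat \<Rightarrow> nat" where
  "class_idx s i j = (THE k. k < length (s i) \<and> j \<in> s i ! k)"

definition rel_liab :: "network \<Rightarrow> profile \<Rightarrow> nat \<Rightarrow> nat \<Rightarrow> real" where
  "rel_liab G s i j = liab G i j / class_liab G s i (class_idx s i j)"

type_synonym payments = "nat \<Rightarrow> nat \<Rightarrow> real"

definition outgoing :: "network \<Rightarrow> payments \<Rightarrow> nat \<Rightarrow> real" where
  "outgoing G p i = (\<Sum>j<nfirms G. p i j)"

definition incoming :: "network \<Rightarrow> payments \<Rightarrow> nat \<Rightarrow> real" where
  "incoming G p i = (\<Sum>j<nfirms G. p j i)"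

text \<open>
  The last conjunct identifies payment matrices with functions vanishing outside the range of
  firms, so that entrywise maximal clearing payments are unique.
\<close>

definition clearing :: "real \<Rightarrow> real \<Rightarrow> network \<Rightarrow> profile \<Rightarrow> payments \<Rightarrow> bool" where
  "clearing \<alpha> \<beta> G s p \<longleftrightarrow>
     (\<forall>i<nfirms G. p i i = 0)
     \<and> (\<forall>i<nfirms G. \<forall>j<nfirms G. 0 \<le> p i j \<and> p i j \<le> liab G i j)
     \<and> (\<forall>i<nfirms G. outgoing G p i =
          (if total_liab G i \<le> assets G i + incoming G p i then total_liab G i
           else \<alpha> * assets G i + \<beta> * incoming G p i))
     \<and> (\<forall>i<nfirms G. \<forall>j\<in>creditors G i. p i j =
          min (max ((outgoing G p i - (\<Sum>m<class_idx s i j. class_liab G s i m))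
                      * rel_liab G s i j) 0)
              (liab G i j))
     \<and> (\<forall>i<nfirms G. \<forall>j<nfirms G. liab G i j = 0 \<longrightarrow> p i j = 0)
     \<and> (\<forall>i j. \<not> (i < nfirms G \<and> j < nfirms G) \<longrightarrow> p i j = 0)"

definition pay_edges :: "network \<Rightarrow> payments \<Rightarrow> (nat \<times> nat) set" where
  "pay_edges G p = {(i, j). i < nfirms G \<and> j < nfirms G \<and> 0 < p i j}"

definition proper :: "network \<Rightarrow> payments \<Rightarrow> bool" where
  "proper G p \<longleftrightarrow> (\<forall>i<nfirms G. 0 < outgoing G p i \<longrightarrow>
     (\<exists>k<nfirms G. 0 < assets G k \<and> (k, i) \<in> (pay_edges G p)\<^sup>*))"

definition max_clearing :: "real \<Rightarrow> real \<Rightarrow> network \<Rightarrow> profile \<Rightarrow> payments \<Rightarrow> bool" where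
  "max_clearing \<alpha> \<beta> G s p \<longleftrightarrow> clearing \<alpha> \<beta> G s p \<and> proper G p
     \<and> (\<forall>q. clearing \<alpha> \<beta> G s q \<and> proper G q \<longrightarrow> (\<forall>i j. q i j \<le> p i j))"

definition clearing_payments :: "real \<Rightarrow> real \<Rightarrow> network \<Rightarrow> profile \<Rightarrow> payments" where
  "clearing_payments \<alpha> \<beta> G s = (THE p. max_clearing \<alpha> \<beta> G s p)"

definition equity :: "network \<Rightarrow> payments \<Rightarrow> nat \<Rightarrow> real" where
  "equity G p i = max 0 (assets G i + incoming G p i - total_liab G i)"

definition social_welfare :: "network \<Rightarrow> payments \<Rightarrow> real" where
  "social_welfare G p = (\<Sum>i<nfirms G. equity G p i)"

definition utility :: "real \<Rightarrow> real \<Rightarrow> network \<Rightarrow> profile \<Rightarrow> nat \<Rightarrow> real" where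
  "utility \<alpha> \<beta> G s i = equity G (clearing_payments \<alpha> \<beta> G s) i"

definition welfare :: "real \<Rightarrow> real \<Rightarrow> network \<Rightarrow> profile \<Rightarrow> real" where
  "welfare \<alpha> \<beta> G s = social_welfare G (clearing_payments \<alpha> \<beta> G s)"

definition nash_equilibria :: "real \<Rightarrow> real \<Rightarrow> network \<Rightarrow> profile set" where
  "nash_equilibria \<alpha> \<beta> G = {s \<in> profiles G. \<forall>i<nfirms G. \<forall>t\<in>strategies G i.
     utility \<alpha> \<beta> G (s(i := t)) i \<le> utility \<alpha> \<beta> G s i}"

lemma finite_profiles: "finite (profiles G)"
proof -
  have fin: "finite (strategies G i)" for i
  proof (rule finite_subset)
    show "strategies G i \<subseteq> {C. set C \<subseteq> Pow (creditors G i) \<and> distinct C}"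
      by (auto simp: strategies_def partition_on_def)
    show "finite {C. set C \<subseteq> Pow (creditors G i) \<and> distinct C}"
      by (rule finite_subset_distinct) (simp add: creditors_def)
  qed
  show ?thesis
  proof (rule finite_subset)
    let ?B = "\<Union>i<nfirms G. strategies G i"
    show "profiles G \<subseteq> {s. \<forall>i. (i \<in> {..<nfirms G} \<longrightarrow> s i \<in> ?B) \<and> (i \<notin> {..<nfirms G} \<longrightarrow> s i = [])}"
      by (auto simp: profiles_def)
    show "finite {s. \<forall>i. (i \<in> {..<nfirms G} \<longrightarrow> s i \<in> ?B) \<and> (i \<notin> {..<nfirms G} \<longrightarrow> s i = [])}"
      by (rule finite_set_of_finite_funs) (auto intro: fin)
  qed
qed

lemma profiles_nonempty: "profiles G \<noteq> {}"
proof -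
  define s where "s i = (if i < nfirms G \<and> creditors G i \<noteq> {} then [creditors G i] else [])" for i
  have "s \<in> profiles G"
    by (auto simp: s_def profiles_def strategies_def partition_on_def)
  then show ?thesis by blast
qed

definition opt :: "real \<Rightarrow> real \<Rightarrow> network \<Rightarrow> real" where
  "opt \<alpha> \<beta> G = Max (welfare \<alpha> \<beta> G ` profiles G)"

definition welfare_ratio :: "real \<Rightarrow> real \<Rightarrow> ereal" where
  "welfare_ratio x y = (if y = 0 then if x = 0 then 1 else \<infinity> else ereal (x / y))"

text \<open>
  There are finitely many profiles, so the supremum below is a maximum whenever an equilibrium
  exists. An instance without equilibria gets the value \<open>-\<infinity>\<close> and does not
  contribute to the price of anarchy of the class.
\<close>

definition poa :: "real \<Rightarrow> real \<Rightarrow> network \<Rightarrow> ereal" where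
  "poa \<alpha> \<beta> G = (SUP s\<in>nash_equilibria \<alpha> \<beta> G. welfare_ratio (opt \<alpha> \<beta> G) (welfare \<alpha> \<beta> G s))"

definition class_poa :: "real \<Rightarrow> real \<Rightarrow> ereal" where
  "class_poa \<alpha> \<beta> = (SUP G\<in>{G. valid_network G}. poa \<alpha> \<beta> G)"

end

theory Submission imports Defs begin

text \<open>
  If \<open>\<alpha> = \<beta> = 0\<close>, a firm pays everything or nothing, so strategies are irrelevant. All lower
  bounds come from a firm 1 that is in default under every profile, hence has equity 0 and cannot
  gain by deviating, but whose choice between its two creditors 2 and 3 decides the welfare.
  For \<open>\<beta> < 1\<close>, firm 3 owes a large debt back to firm 1, so that money sent to firm 3 is eaten up
  by default costs along the cycle between 1 and 3, whereas money sent to firm 2 is equity. For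
  \<open>\<beta> = 1\<close>, firm 3 has large external assets \<open>M\<close>, of which only \<open>\<alpha> M\<close> survives unless firm 1
  prioritises firm 3 and thereby makes it solvent.
\<close>

section \<open>No recovery in default\<close>

text \<open>Distinct classes are disjoint, so a creditor lies in exactly one class, and the
  liabilities of the first \<open>Suc k\<close> classes add up to one sum over a set of creditors.
  In that form they can be compared with \<open>total_liab\<close>.\<close>

lemma strategy_classes:
  assumes "s \<in> profiles G" "i < nfirms G" "j \<in> creditors G i"
  defines "k \<equiv> class_idx s i j"
  shows "k < length (s i)" "j \<in> s i ! k" "s i ! k \<subseteq> creditors G i"
    and "(\<Sum>m<Suc k. class_liab G s i m) = (\<Sum>j\<in>(\<Union>m<Suc k. s i ! m). liab G i j)"
    and "(\<Union>m<Suc k. s i ! m) \<subseteq> creditors G i"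
proof -
  have "s i \<in> strategies G i"
    using assms by (auto simp: profiles_def)
  then have d: "distinct (s i)" and un: "\<Union>(set (s i)) = creditors G i"
    and dis: "disjoint (set (s i))"
    by (auto simp: strategies_def partition_on_def)
  have disj: "s i ! a \<inter> s i ! b = {}" if "a < length (s i)" "b < length (s i)" "a \<noteq> b" for a b
    using that d dis by (meson disjointD nth_eq_iff_index_eq nth_mem)
  obtain a where a: "a < length (s i)" "j \<in> s i ! a"
    using un assms(3) by (metis UnionE in_set_conv_nth)
  have "k = a"
    unfolding k_def class_idx_def using a disj by (intro the_equality) auto
  then show k: "k < length (s i)" "j \<in> s i ! k"
    using a by auto
  have sub: "s i ! m \<subseteq> creditors G i" if "m < length (s i)" for m
    using that un nth_mem by blast
  then show "s i ! k \<subseteq> creditors G i"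
    using k(1) by blast
  show "(\<Union>m<Suc k. s i ! m) \<subseteq> creditors G i"
    using k(1) by (intro UN_least sub) simp
  have "finite (s i ! m)" if "m < length (s i)" for m
    using sub[OF that] finite_subset by (fastforce simp: creditors_def)
  then show "(\<Sum>m<Suc k. class_liab G s i m) = (\<Sum>j\<in>(\<Union>m<Suc k. s i ! m). liab G i j)"
    unfolding class_liab_def using k(1) disj
    by (intro sum.UNION_disjoint[symmetric]) auto
qed

text \<open>The two extreme budgets make every strategy prescribe the same entry. The classes up to
  and including \<open>k\<close> together owe at most \<open>total_liab G i\<close>, so after the
  earlier classes a full budget still covers class \<open>k\<close>. With budget 0 the first factor
  is at most 0 and the maximum cuts it off.\<close>

lemma priority_formula_trivial:
  assumes "valid_network G" "s \<in> profiles G" "i < nfirms G" "j \<in> creditors G i"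
  defines "k \<equiv> class_idx s i j"
  shows "min (max ((total_liab G i - (\<Sum>m<k. class_liab G s i m)) * rel_liab G s i j) 0)
           (liab G i j) = liab G i j"
    and "min (max ((0 - (\<Sum>m<k. class_liab G s i m)) * rel_liab G s i j) 0) (liab G i j) = 0"
proof -
  note c = strategy_classes[OF assms(2-4), folded k_def]
  have nn: "0 \<le> liab G i j'" if "j' < nfirms G" for j'
    using assms that by (auto simp: valid_network_def)
  have lpos: "0 < liab G i j"
    using assms by (auto simp: creditors_def)
  have fin: "finite (creditors G i)"
    by (simp add: creditors_def)
  have "liab G i j \<le> class_liab G s i k"
    unfolding class_liab_def using c(2,3) fin
    by (intro member_le_sum) (auto simp: creditors_def intro: finite_subset)
  then have cpos: "0 < class_liab G s i k"
    using lpos by simp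
  have le: "(\<Sum>m<Suc k. class_liab G s i m) \<le> total_liab G i"
    unfolding c(4) total_liab_def using c(5) nn
    by (intro sum_mono2) (auto simp: creditors_def)
  have "liab G i j = class_liab G s i k * rel_liab G s i j"
    using cpos by (simp add: rel_liab_def k_def)
  also have "\<dots> \<le> (total_liab G i - (\<Sum>m<k. class_liab G s i m)) * rel_liab G s i j"
    using le lpos cpos by (intro mult_right_mono) (auto simp: rel_liab_def k_def)
  finally show "min (max ((total_liab G i - (\<Sum>m<k. class_liab G s i m)) * rel_liab G s i j) 0)
      (liab G i j) = liab G i j"
    by simp
  have "0 \<le> class_liab G s i m" if "m < k" for m
    unfolding class_liab_def
  proof (rule sum_nonneg)
    fix j' assume "j' \<in> s i ! m"
    moreover have "s i ! m \<subseteq> (\<Union>m<Suc k. s i ! m)"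
      using that by (intro UN_upper) simp
    ultimately have "j' \<in> creditors G i"
      using c(5) by blast
    then show "0 \<le> liab G i j'"
      by (simp add: creditors_def)
  qed
  then have "0 \<le> (\<Sum>m<k. class_liab G s i m)"
    by (intro sum_nonneg) auto
  moreover have "0 \<le> rel_liab G s i j"
    using lpos cpos by (simp add: rel_liab_def k_def)
  ultimately have "(0 - (\<Sum>m<k. class_liab G s i m)) * rel_liab G s i j \<le> 0"
    by (simp add: mult_nonneg_nonneg)
  then show "min (max ((0 - (\<Sum>m<k. class_liab G s i m)) * rel_liab G s i j) 0) (liab G i j) = 0"
    using lpos by simp
qed

text \<open>Without recovery a firm pays its whole debt or nothing. Together with
  \<open>0 \<le> p i j \<le> liab G i j\<close> either total fixes the whole row, and on such rows
  the priority formula holds for every strategy.\<close>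

lemma clearing_no_recovery_indep:
  assumes G: "valid_network G" and s: "s \<in> profiles G" "s' \<in> profiles G"
    and c: "clearing 0 0 G s p"
  shows "clearing 0 0 G s' p"
proof -
  have "p i j = min (max ((outgoing G p i - (\<Sum>m<class_idx s' i j. class_liab G s' i m))
            * rel_liab G s' i j) 0) (liab G i j)"
    if i: "i < nfirms G" and j: "j \<in> creditors G i" for i j
  proof -
    have bnd: "0 \<le> p i j'" "p i j' \<le> liab G i j'" if "j' < nfirms G" for j'
      using c i that by (auto simp: clearing_def)
    have j': "j < nfirms G"
      using j by (simp add: creditors_def)
    have "outgoing G p i = total_liab G i \<or> outgoing G p i = 0"
      using c i by (auto simp: clearing_def)
    then show ?thesis
    proof
      assume o: "outgoing G p i = total_liab G i"
      have "(\<Sum>j<nfirms G. liab G i j - p i j) = 0"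
        using o by (simp add: outgoing_def total_liab_def sum_subtractf)
      then have "p i j = liab G i j"
        using bnd j' by (subst (asm) sum_nonneg_eq_0_iff) auto
      then show ?thesis
        using priority_formula_trivial(1)[OF G s(2) i j] o by simp
    next
      assume o: "outgoing G p i = 0"
      then have "p i j = 0"
        using bnd j' unfolding outgoing_def by (subst (asm) sum_nonneg_eq_0_iff) auto
      then show ?thesis
        using priority_formula_trivial(2)[OF G s(2) i j] o by simp
    qed
  qed
  then show ?thesis
    using c by (simp add: clearing_def)
qed

lemma clearing_payments_no_recovery:
  assumes "valid_network G" "s \<in> profiles G" "s' \<in> profiles G"
  shows "clearing_payments 0 0 G s = clearing_payments 0 0 G s'"
proof -
  have "clearing 0 0 G s = clearing 0 0 G s'"
    using clearing_no_recovery_indep[OF assms] clearing_no_recovery_indep[OF assms(1,3,2)]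
    by (intro ext iffI)
  then show ?thesis
    by (simp add: clearing_payments_def max_clearing_def)
qed

text \<open>All profiles share one clearing matrix, so each of them is an equilibrium and attains
  the optimum. If the common welfare is 0, the convention 0/0 = 1 applies.\<close>

lemma poa_no_recovery:
  assumes G: "valid_network G"
  shows "poa 0 0 G = 1"
proof -
  obtain s where s: "s \<in> profiles G"
    using profiles_nonempty by blast
  have eq: "welfare 0 0 G s' = welfare 0 0 G s" if "s' \<in> profiles G" for s'
    using clearing_payments_no_recovery[OF G that s] by (simp add: welfare_def)
  have "s(i := t) \<in> profiles G" if "i < nfirms G" "t \<in> strategies G i" for i t
    using s that by (auto simp: profiles_def)
  then have "clearing_payments 0 0 G (s(i := t)) = clearing_payments 0 0 G s"
    if "i < nfirms G" "t \<in> strategies G i" for i t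
    using clearing_payments_no_recovery[OF G _ s] that by blast
  then have nash: "s \<in> nash_equilibria 0 0 G"
    using s by (simp add: nash_equilibria_def utility_def)
  have "welfare 0 0 G ` profiles G = (\<lambda>_. welfare 0 0 G s) ` profiles G"
    using eq by (rule image_cong[OF refl])
  also have "\<dots> = {welfare 0 0 G s}"
    using s by auto
  finally have "opt 0 0 G = welfare 0 0 G s"
    by (simp add: opt_def)
  then have "welfare_ratio (opt 0 0 G) (welfare 0 0 G s') = 1" if "s' \<in> profiles G" for s'
    unfolding eq[OF that] by (simp add: welfare_ratio_def one_ereal_def)
  then have "poa 0 0 G = (SUP s\<in>nash_equilibria 0 0 G. 1)"
    unfolding poa_def by (intro SUP_cong) (auto simp: nash_equilibria_def)
  \<comment> \<open>An equilibrium has to be exhibited: over the empty set the supremum would be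
    -infinity instead of 1.\<close>
  moreover have "nash_equilibria 0 0 G \<noteq> {}"
    using nash by blast
  ultimately show ?thesis
    by simp
qed

section \<open>A family of four-firm networks\<close>

text \<open>
  The debt \<open>e1 + 1 + N\<close> of firm 1 to each of its two creditors is at least its largest possible
  means, so firm 1 is always in default and can pay everything it has to its preferred creditor.
\<close>

definition net :: "real \<Rightarrow> real \<Rightarrow> real \<Rightarrow> network" where
  "net e1 e3 N = \<lparr>nfirms = 4,
     assets = (\<lambda>i. if i = 0 then 1 else if i = 1 then e1 else if i = 3 then e3 else 0),
     liab = (\<lambda>i j. if i = 0 \<and> j = 1 then 1
       else if i = 1 \<and> (j = 2 \<or> j = 3) then e1 + 1 + N
       else if i = 3 \<and> j = 1 then N else 0)\<rparr>"

text \<open>Firm 1 is the only firm with more than one creditor, so its strategy \<open>t\<close>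
  determines the profile.\<close>

definition prof :: "strategy \<Rightarrow> profile" where
  "prof t i = (if i = 0 \<or> i = 3 then [{1}] else if i = 1 then t else [])"

text \<open>Under strategy \<open>t\<close>, firm 1 sends the fraction \<open>\<theta>\<close> of its payments to firm 3.\<close>

definition splits :: "strategy \<Rightarrow> real \<Rightarrow> bool" where
  "splits t \<theta> \<longleftrightarrow> t = [{2}, {3}] \<and> \<theta> = 0 \<or> t = [{3}, {2}] \<and> \<theta> = 1 \<or> t = [{2, 3}] \<and> \<theta> = 1 / 2"

text \<open>\<open>T\<close> stands for the total payment of firm 1 and \<open>y\<close> for the
  payment of firm 3 back to firm 1.\<close>

definition pay :: "real \<Rightarrow> real \<Rightarrow> real \<Rightarrow> payments" where
  "pay \<theta> T y i j = (if i = 0 \<and> j = 1 then 1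
     else if i = 1 \<and> j = 2 then (1 - \<theta>) * T
     else if i = 1 \<and> j = 3 then \<theta> * T
     else if i = 3 \<and> j = 1 then y else 0)"

lemma all_less_4: "(\<forall>i<4::nat. P i) \<longleftrightarrow> P 0 \<and> P 1 \<and> P 2 \<and> P 3"
proof -
  have "i < 4 \<longleftrightarrow> i = 0 \<or> i = 1 \<or> i = 2 \<or> i = 3" for i :: nat
    by auto
  then show ?thesis by auto
qed

lemma sum_less_4: "(\<Sum>i<4::nat. f i) = f 0 + f 1 + f 2 + (f 3 :: real)"
  by (simp add: eval_nat_numeral add.assoc)

lemma nfirms_net [simp]: "nfirms (net e1 e3 N) = 4"
  by (simp add: net_def)

lemma valid_net: "0 \<le> e1 \<Longrightarrow> 0 \<le> e3 \<Longrightarrow> 0 \<le> N \<Longrightarrow> valid_network (net e1 e3 N)"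
  by (auto simp: valid_network_def net_def)

lemma creditors_net:
  assumes "0 \<le> e1" "0 < N"
  shows "creditors (net e1 e3 N) i =
    (if i = 0 \<or> i = 3 then {1} else if i = 1 then {2, 3} else {})"
  using assms by (auto simp: creditors_def net_def split: if_splits)

section \<open>Strategies of firms with at most two creditors\<close>

lemma strategies_empty: "creditors G i = {} \<Longrightarrow> strategies G i = {[]}"
  by (auto simp: strategies_def partition_on_empty)

lemma strategies_singleton:
  assumes "creditors G i = {j}"
  shows "strategies G i = {[{j}]}"
proof -
  have "C = [{j}]" if "C \<in> strategies G i" for C
  proof -
    have d: "distinct C" and u: "\<Union>(set C) = {j}" and ne: "{} \<notin> set C"
      using that assms by (auto simp: strategies_def partition_on_def)
    have sub: "X = {j}" if "X \<in> set C" for X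
    proof -
      have "X \<subseteq> {j}" "X \<noteq> {}"
        using that ne unfolding u[symmetric] by auto
      then show ?thesis by auto
    qed
    have "set C \<noteq> {}"
      using u by auto
    moreover have "set C \<subseteq> {{j}}"
      using sub by blast
    ultimately have "set C = {{j}}"
      using subset_singletonD by metis
    moreover from this have "length C = 1"
      using distinct_card[OF d] by simp
    ultimately show ?thesis
      by (cases C) simp_all
  qed
  moreover have "[{j}] \<in> strategies G i"
    using assms by (simp add: strategies_def partition_on_def)
  ultimately show ?thesis by blast
qed

text \<open>If \<open>{a, b}\<close> is itself a class, disjointness leaves room for no other.
  Otherwise all classes are singletons and both must occur, in one of two orders.\<close>

lemma strategies_pair:
  assumes cr: "creditors G i = {a, b}" and C: "C \<in> strategies G i"
  shows "C = [{a}, {b}] \<or> C = [{b}, {a}] \<or> C = [{a, b}]"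
proof -
  have d: "distinct C" and u: "\<Union>(set C) = {a, b}" and ne: "{} \<notin> set C"
    and dis: "disjoint (set C)"
    using C cr by (auto simp: strategies_def partition_on_def)
  have sub: "set C \<subseteq> {{a}, {b}, {a, b}}"
  proof
    fix X assume X: "X \<in> set C"
    then have "X \<subseteq> {a, b}" "X \<noteq> {}"
      using ne unfolding u[symmetric] by auto
    then show "X \<in> {{a}, {b}, {a, b}}" by blast
  qed
  show ?thesis
  proof (cases "{a, b} \<in> set C")
    case True
    have "X = {a, b}" if X: "X \<in> set C" for X
    proof (rule ccontr)
      assume "X \<noteq> {a, b}"
      then have "X \<inter> {a, b} = {}"
        using dis True X by (meson disjointD)
      moreover have "X \<subseteq> {a, b}" "X \<noteq> {}"
        using X ne unfolding u[symmetric] by auto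
      ultimately show False by blast
    qed
    then have "set C = {{a, b}}"
      using True by blast
    moreover from this have "length C = 1"
      using distinct_card[OF d] by simp
    ultimately show ?thesis
      by (cases C) simp_all
  next
    case False
    then have sub: "set C \<subseteq> {{a}, {b}}"
      using sub by blast
    have "{a} \<in> set C" "{b} \<in> set C"
      using u sub by blast+
    then have eq: "set C = {{a}, {b}}"
      using sub by blast
    \<comment> \<open>For \<open>a = b\<close> the class \<open>{a}\<close> would be the excluded
      class \<open>{a, b}\<close>.\<close>
    have "{a} \<noteq> {b}"
      using False \<open>{a} \<in> set C\<close> by auto
    then have "length C = 2"
      using distinct_card[OF d] eq by simp
    then obtain x y where "C = [x, y]"
      by (auto simp: numeral_2_eq_2 length_Suc_conv)
    then show ?thesis
      using eq \<open>{a} \<noteq> {b}\<close> by (auto simp: doubleton_eq_iff)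
  qed
qed

section \<open>Clearing payments of the family\<close>

lemma class_idx_eq:
  assumes "k < length (s i)" "j \<in> s i ! k"
    and "\<And>k'. k' < length (s i) \<Longrightarrow> j \<in> s i ! k' \<Longrightarrow> k' = k"
  shows "class_idx s i j = k"
  unfolding class_idx_def using assms by blast

text \<open>Each creditor of firm 1 is owed at least \<open>x\<close>, so under a strict order the
  first class absorbs everything and nothing is left for the second. Since both debts are equal, a
  tie splits \<open>x\<close> in halves.\<close>

lemma priority_formula_net:
  fixes e1 e3 N \<theta> x :: real
  assumes "splits t \<theta>" "0 \<le> e1" "0 < N" "0 \<le> x" "x \<le> e1 + 1 + N"
  defines "G \<equiv> net e1 e3 N"
  shows "min (max ((x - (\<Sum>m<class_idx (prof t) 1 2. class_liab G (prof t) 1 m))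
                      * rel_liab G (prof t) 1 2) 0) (liab G 1 2) = (1 - \<theta>) * x"
    and "min (max ((x - (\<Sum>m<class_idx (prof t) 1 3. class_liab G (prof t) 1 m))
                      * rel_liab G (prof t) 1 3) 0) (liab G 1 3) = \<theta> * x"
proof -
  define K where "K = e1 + 1 + N"
  have K: "0 < K" "x \<le> K"
    using assms by (auto simp: K_def)
  have L: "liab G 1 2 = K" "liab G 1 3 = K"
    by (auto simp: G_def net_def K_def)
  consider (a) "t = [{2}, {3}]" "\<theta> = 0" | (b) "t = [{3}, {2}]" "\<theta> = 1"
    | (c) "t = [{2, 3}]" "\<theta> = 1 / 2"
    using assms(1) by (auto simp: splits_def)
  then have "min (max ((x - (\<Sum>m<class_idx (prof t) 1 2. class_liab G (prof t) 1 m))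
                      * rel_liab G (prof t) 1 2) 0) (liab G 1 2) = (1 - \<theta>) * x
    \<and> min (max ((x - (\<Sum>m<class_idx (prof t) 1 3. class_liab G (prof t) 1 m))
                      * rel_liab G (prof t) 1 3) 0) (liab G 1 3) = \<theta> * x"
  proof cases
    case a
    have "class_idx (prof t) 1 2 = 0" "class_idx (prof t) 1 3 = 1"
      by (rule class_idx_eq; auto simp: prof_def a less_Suc_eq)+
    then show ?thesis
      using K L assms(4) by (simp add: rel_liab_def class_liab_def prof_def a)
  next
    case b
    have "class_idx (prof t) 1 2 = 1" "class_idx (prof t) 1 3 = 0"
      by (rule class_idx_eq; auto simp: prof_def b less_Suc_eq)+
    then show ?thesis
      using K L assms(4) by (simp add: rel_liab_def class_liab_def prof_def b)
  next
    case c
    have "class_idx (prof t) 1 2 = 0" "class_idx (prof t) 1 3 = 0"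
      by (rule class_idx_eq; auto simp: prof_def c less_Suc_eq)+
    then show ?thesis
      using K L assms(4) by (simp add: rel_liab_def class_liab_def prof_def c)
  qed
  then show "min (max ((x - (\<Sum>m<class_idx (prof t) 1 2. class_liab G (prof t) 1 m))
                      * rel_liab G (prof t) 1 2) 0) (liab G 1 2) = (1 - \<theta>) * x"
    and "min (max ((x - (\<Sum>m<class_idx (prof t) 1 3. class_liab G (prof t) 1 m))
                      * rel_liab G (prof t) 1 3) 0) (liab G 1 3) = \<theta> * x"
    by blast+
qed

text \<open>The total payment of firm 1 in default when firm 3 pays it \<open>y\<close>. The 1 comes
  from firm 0, which turns an external asset into an incoming payment, discounted by \<beta> instead
  of \<alpha>.\<close>

definition default_pay :: "real \<Rightarrow> real \<Rightarrow> real \<Rightarrow> real \<Rightarrow> real" where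
  "default_pay \<alpha> \<beta> e1 y = \<alpha> * e1 + \<beta> * (1 + y)"

text \<open>Firm 0 is always solvent and firm 1 always in default, so their payments are determined
  by \<open>y\<close>, and the only equation left is the one of firm 3.\<close>

lemma clearing_net_iff:
  fixes \<alpha> \<beta> e1 e3 N \<theta> :: real
  assumes "splits t \<theta>" "0 \<le> e1" "0 \<le> e3" "0 < N" "\<alpha> \<in> {0..1}" "\<beta> \<in> {0..1}"
  shows "clearing \<alpha> \<beta> (net e1 e3 N) (prof t) q \<longleftrightarrow>
    (\<exists>y. let T = default_pay \<alpha> \<beta> e1 y in q = pay \<theta> T y \<and> 0 \<le> y \<and> y \<le> N
      \<and> y = (if N \<le> e3 + \<theta> * T then N else \<alpha> * e3 + \<beta> * (\<theta> * T)))"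
    (is "?L \<longleftrightarrow> ?R")
proof -
  define G where "G = net e1 e3 N"
  define s where "s = prof t"
  define K where "K = e1 + 1 + N"
  have K: "0 < K"
    using assms by (simp add: K_def)
  have th: "0 \<le> \<theta>" "\<theta> \<le> 1"
    using assms(1) by (auto simp: splits_def)
  have n: "nfirms G = 4"
    by (simp add: G_def)
  have cr: "creditors G 0 = {1}" "creditors G 1 = {2, 3}" "creditors G 2 = {}"
    "creditors G 3 = {1}"
    unfolding G_def using assms by (auto simp: creditors_net)
  have as: "assets G 0 = 1" "assets G 1 = e1" "assets G 2 = 0" "assets G 3 = e3"
    by (auto simp: G_def net_def)
  have li: "liab G 0 1 = 1" "liab G 1 2 = K" "liab G 1 3 = K" "liab G 3 1 = N"
    "liab G 0 0 = 0" "liab G 0 2 = 0" "liab G 0 3 = 0" "liab G 1 0 = 0" "liab G 1 1 = 0"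
    "liab G 2 0 = 0" "liab G 2 1 = 0" "liab G 2 2 = 0" "liab G 2 3 = 0"
    "liab G 3 0 = 0" "liab G 3 2 = 0" "liab G 3 3 = 0"
    by (auto simp: G_def net_def K_def)
  have tl: "total_liab G 0 = 1" "total_liab G 1 = 2 * K" "total_liab G 2 = 0" "total_liab G 3 = N"
    unfolding total_liab_def n sum_less_4 li by auto
  have idx: "class_idx s 0 1 = 0" "class_idx s 3 1 = 0"
    by (rule class_idx_eq; auto simp: s_def prof_def)+
  have rel: "rel_liab G s 0 1 = 1" "rel_liab G s 3 1 = 1"
    unfolding rel_liab_def class_liab_def idx using li assms(4) by (auto simp: s_def prof_def)
  \<comment> \<open>These are the bounds under which \<open>priority_formula_net\<close> applies to
    firm 1; the upper one uses that default costs never increase its means.\<close>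
  have T0: "0 \<le> default_pay \<alpha> \<beta> e1 y" "default_pay \<alpha> \<beta> e1 y \<le> K"
    if "0 \<le> y" "y \<le> N" for y
  proof -
    have "default_pay \<alpha> \<beta> e1 y \<le> 1 * e1 + 1 * (1 + y)"
      unfolding default_pay_def using assms that by (intro add_mono mult_right_mono) auto
    then show "default_pay \<alpha> \<beta> e1 y \<le> K"
      using that by (simp add: K_def)
    show "0 \<le> default_pay \<alpha> \<beta> e1 y"
      using assms that by (simp add: default_pay_def)
  qed
  note pf = priority_formula_net[OF assms(1,2,4), of _ e3, folded G_def s_def K_def]
  show ?thesis
  proof
    assume L: ?L
    define y where "y = q 3 1"
    define T where "T = default_pay \<alpha> \<beta> e1 y"
    note c = L[folded G_def s_def, unfolded clearing_def n]
    note bnd = c[THEN conjunct2, THEN conjunct1, rule_format]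
    note c' = c[THEN conjunct2, THEN conjunct2]
    note out = c'[THEN conjunct1, rule_format]
    note prio = c'[THEN conjunct2, THEN conjunct1, rule_format]
    note zero = c'[THEN conjunct2, THEN conjunct2, THEN conjunct1, rule_format]
    note outside = c'[THEN conjunct2, THEN conjunct2, THEN conjunct2, rule_format]
    have z: "q 0 0 = 0" "q 0 2 = 0" "q 0 3 = 0" "q 1 0 = 0" "q 1 1 = 0" "q 2 0 = 0"
      "q 2 1 = 0" "q 2 2 = 0" "q 2 3 = 0" "q 3 0 = 0" "q 3 2 = 0" "q 3 3 = 0"
      by (rule zero; simp add: li[unfolded One_nat_def])+
    have y: "0 \<le> y" "y \<le> N"
      using bnd[of 3 1] by (simp_all add: y_def li[unfolded One_nat_def])
    have sums: "outgoing G q 0 = q 0 1" "outgoing G q 1 = q 1 2 + q 1 3" "outgoing G q 3 = y"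
      "incoming G q 0 = 0" "incoming G q 1 = q 0 1 + y" "incoming G q 3 = q 1 3"
      unfolding outgoing_def incoming_def n sum_less_4 z y_def by simp_all
    have q01: "q 0 1 = 1"
      using out[of 0] unfolding sums tl as by simp
    \<comment> \<open>The means of firm 1 are at most \<open>K\<close> because
      \<open>y \<le> N\<close>, and \<open>K\<close> is positive, so the default branch
      applies.\<close>
    have "\<not> 2 * K \<le> e1 + (1 + y)"
      using y K_def assms by simp
    then have o1: "outgoing G q 1 = T"
      using out[of 1] unfolding sums(5) tl as q01 by (simp add: T_def default_pay_def)
    have q1: "q 1 2 = (1 - \<theta>) * T" "q 1 3 = \<theta> * T"
      using prio[of 1 2] prio[of 1 3] T0[OF y] unfolding o1 T_def by (simp_all only: pf cr) auto
    have "y = (if N \<le> e3 + \<theta> * T then N else \<alpha> * e3 + \<beta> * (\<theta> * T))"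
      using out[of 3] unfolding sums tl as q1 by simp
    moreover have "q = pay \<theta> T y"
    proof (intro ext)
      fix i j :: nat
      consider "i \<in> {0, 1, 2, 3}" "j \<in> {0, 1, 2, 3}" | "\<not> (i < 4 \<and> j < 4)"
        by fastforce
      then show "q i j = pay \<theta> T y i j"
      proof cases
        case 1
        then show ?thesis
          using z q01 q1 by (auto simp: pay_def y_def)
      next
        case 2
        then show ?thesis
          using outside[of i j] by (auto simp: pay_def)
      qed
    qed
    ultimately show ?R
      using y unfolding Let_def T_def by blast
  next
    assume ?R
    then obtain y where y: "0 \<le> y" "y \<le> N"
      and q: "q = pay \<theta> (default_pay \<alpha> \<beta> e1 y) y"
      and ye: "y = (if N \<le> e3 + \<theta> * default_pay \<alpha> \<beta> e1 y then N
        else \<alpha> * e3 + \<beta> * (\<theta> * default_pay \<alpha> \<beta> e1 y))"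
      unfolding Let_def by blast
    define T where "T = default_pay \<alpha> \<beta> e1 y"
    note T = T0[OF y, folded T_def]
    have qv: "q 0 1 = 1" "q 1 2 = (1 - \<theta>) * T" "q 1 3 = \<theta> * T" "q 3 1 = y"
      "q 0 0 = 0" "q 0 2 = 0" "q 0 3 = 0" "q 1 0 = 0" "q 1 1 = 0" "q 2 0 = 0"
      "q 2 1 = 0" "q 2 2 = 0" "q 2 3 = 0" "q 3 0 = 0" "q 3 2 = 0" "q 3 3 = 0"
      by (auto simp: q pay_def T_def)
    have d1: "\<not> 2 * K \<le> e1 + (1 + y)"
      using y K_def assms by simp
    have "(1 - \<theta>) * T \<le> T" "\<theta> * T \<le> T"
      using th T by (auto simp: mult_left_le_one_le)
    then have bd: "0 \<le> (1 - \<theta>) * T" "0 \<le> \<theta> * T" "(1 - \<theta>) * T \<le> K" "\<theta> * T \<le> K"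
      using th T by auto
    have out: "q i j = 0" if "\<not> (i < 4 \<and> j < 4)" for i j
      using that by (auto simp: q pay_def)
    have sums: "outgoing G q 0 = 1" "outgoing G q 1 = T" "outgoing G q 2 = 0" "outgoing G q 3 = y"
      "incoming G q 0 = 0" "incoming G q 1 = 1 + y" "incoming G q 2 = (1 - \<theta>) * T"
      "incoming G q 3 = \<theta> * T"
      unfolding outgoing_def incoming_def n sum_less_4 qv by (simp_all add: algebra_simps)
    have "\<forall>i<4. outgoing G q i = (if total_liab G i \<le> assets G i + incoming G q i
        then total_liab G i else \<alpha> * assets G i + \<beta> * incoming G q i)"
      unfolding all_less_4 sums tl as
    proof (intro conjI)
      show "T = (if 2 * K \<le> e1 + (1 + y) then 2 * K else \<alpha> * e1 + \<beta> * (1 + y))"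
        using d1 by (simp add: T_def default_pay_def)
    qed (use ye[folded T_def] bd in simp_all)
    moreover have "\<forall>i<4. q i i = 0" "\<forall>i<4. \<forall>j<4. 0 \<le> q i j \<and> q i j \<le> liab G i j"
      "\<forall>i<4. \<forall>j<4. liab G i j = 0 \<longrightarrow> q i j = 0"
      unfolding all_less_4 qv li using y bd K assms(4) by simp_all
    moreover have "\<forall>i<4. \<forall>j\<in>creditors G i. q i j =
        min (max ((outgoing G q i - (\<Sum>m<class_idx s i j. class_liab G s i m))
          * rel_liab G s i j) 0) (liab G i j)"
      unfolding all_less_4 cr ball_simps sums qv pf[OF T, unfolded li] idx rel li using y assms(4) by simp
    ultimately have "clearing \<alpha> \<beta> G s q"
      unfolding clearing_def n using out by blast
    then show ?L
      by (simp add: G_def s_def)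
  qed
qed

text \<open>A clearing matrix of the network is determined by the payment \<open>y\<close> of firm 3 to firm 1.\<close>

definition max_solution :: "real \<Rightarrow> real \<Rightarrow> real \<Rightarrow> real \<Rightarrow> real \<Rightarrow> real \<Rightarrow> real \<Rightarrow> bool" where
  "max_solution \<alpha> \<beta> e1 e3 N \<theta> y \<longleftrightarrow>
    (let solution = (\<lambda>y. 0 \<le> y \<and> y \<le> N \<and>
       y = (if N \<le> e3 + \<theta> * default_pay \<alpha> \<beta> e1 y then N
            else \<alpha> * e3 + \<beta> * (\<theta> * default_pay \<alpha> \<beta> e1 y)))
     in solution y \<and> (\<forall>y'. solution y' \<longrightarrow> y' \<le> y))"

lemma max_clearing_unique:
  assumes "max_clearing \<alpha> \<beta> G s p"
  shows "clearing_payments \<alpha> \<beta> G s = p"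
  unfolding clearing_payments_def
proof (rule the_equality[where P = "max_clearing \<alpha> \<beta> G s", OF assms])
  fix q assume "max_clearing \<alpha> \<beta> G s q"
  then show "q = p"
    using assms by (intro ext antisym) (auto simp: max_clearing_def)
qed

text \<open>Every entry of \<open>pay\<close> is non-decreasing in \<open>y\<close>, so the largest
  solution yields a matrix above all clearing matrices, proper or not. It remains to see that this
  matrix is itself proper: its payments can be traced back to the assets of firm 0 or of firm
  3.\<close>

lemma clearing_payments_net:
  assumes "splits t \<theta>" "0 \<le> e1" "0 \<le> e3" "0 < N" "\<alpha> \<in> {0..1}" "\<beta> \<in> {0..1}"
    and y: "max_solution \<alpha> \<beta> e1 e3 N \<theta> y"
  shows "clearing_payments \<alpha> \<beta> (net e1 e3 N) (prof t) = pay \<theta> (default_pay \<alpha> \<beta> e1 y) y"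
proof (rule max_clearing_unique)
  define T where "T = default_pay \<alpha> \<beta> e1 y"
  define p where "p = pay \<theta> T y"
  define G where "G = net e1 e3 N"
  have th: "0 \<le> \<theta>" "\<theta> \<le> 1"
    using assms(1) by (auto simp: splits_def)
  note iff = clearing_net_iff[OF assms(1-6), unfolded Let_def]
  have eq: "0 \<le> y" "y \<le> N" "y = (if N \<le> e3 + \<theta> * T then N else \<alpha> * e3 + \<beta> * (\<theta> * T))"
    using y by (auto simp: max_solution_def T_def Let_def)
  have le: "q i j \<le> p i j" if q: "clearing \<alpha> \<beta> G (prof t) q" for q i j
  proof -
    obtain y' where y': "q = pay \<theta> (default_pay \<alpha> \<beta> e1 y') y'" "y' \<le> y"
      using q iff[of q] y unfolding G_def max_solution_def Let_def by blast
    have "default_pay \<alpha> \<beta> e1 y' \<le> T"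
      using y'(2) assms(6) by (auto simp: T_def default_pay_def intro: mult_left_mono)
    then show ?thesis
      using th y' by (auto simp: p_def pay_def intro: mult_left_mono)
  qed
  have e01: "(0, 1) \<in> pay_edges G p"
    by (simp add: pay_edges_def p_def pay_def G_def)
  have "proper G p"
    unfolding proper_def
  proof (intro allI impI)
    fix i assume i: "i < nfirms G" and o: "0 < outgoing G p i"
    have as: "0 < assets G 0" "0 < nfirms G"
      by (simp_all add: G_def net_def)
    have "i \<noteq> 2"
      using o by (auto simp: outgoing_def p_def pay_def)
    then consider "i = 0" | "i = 1" | "i = 3"
      using i by (fastforce simp: G_def)
    then show "\<exists>k<nfirms G. 0 < assets G k \<and> (k, i) \<in> (pay_edges G p)\<^sup>*"
    proof cases
      case 3
      show ?thesis
      proof (cases "0 < e3")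
        case True
        then show ?thesis
          using 3 i by (intro exI[of _ 3]) (simp add: G_def net_def)
      next
        case False
        then have "e3 = 0"
          using assms(3) by simp
        have "0 < y"
          using o 3 by (simp add: outgoing_def G_def sum_less_4 p_def pay_def)
        \<comment> \<open>Without assets of its own, firm 3 can only pass on money received from
          firm 1, which gives the path from 0 over 1 to 3.\<close>
        then have "0 < \<theta> * T"
        proof (cases "N \<le> \<theta> * T")
          case False
          then have "0 < \<beta> * (\<theta> * T)"
            using eq(3) \<open>e3 = 0\<close> \<open>0 < y\<close> by simp
          then show ?thesis
            using assms(6) by (simp add: zero_less_mult_iff)
        qed (use assms(4) in simp)
        then have "(1, 3) \<in> pay_edges G p"
          by (simp add: pay_edges_def p_def pay_def G_def)
        then show ?thesis
          using as e01 3 by (meson rtrancl.rtrancl_into_rtrancl rtrancl.rtrancl_refl)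
      qed
    qed (use as e01 in auto)
  qed
  moreover have "clearing \<alpha> \<beta> G (prof t) p"
    using iff[of p] eq unfolding G_def p_def T_def by blast
  ultimately show "max_clearing \<alpha> \<beta> (net e1 e3 N) (prof t) (pay \<theta> (default_pay \<alpha> \<beta> e1 y) y)"
    using le unfolding max_clearing_def G_def p_def T_def by blast
qed

section \<open>Welfare, equilibria and a lower bound on the price of anarchy\<close>

lemma equity_net:
  fixes e1 e3 N \<theta> T y :: real
  assumes "0 \<le> e1" "0 < N" "0 \<le> y" "y \<le> N" "0 \<le> T" "\<theta> \<le> 1"
  defines "E \<equiv> equity (net e1 e3 N) (pay \<theta> T y)"
  shows "E 0 = 0" "E 1 = 0" "E 2 = (1 - \<theta>) * T" "E 3 = max 0 (e3 + \<theta> * T - N)"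
  using assms
  by (auto simp: E_def equity_def incoming_def total_liab_def sum_less_4 pay_def net_def)

text \<open>Only firms 2 and 3 can have positive equity; the two summands are theirs.\<close>

definition net_welfare :: "real \<Rightarrow> real \<Rightarrow> real \<Rightarrow> real \<Rightarrow> real \<Rightarrow> real \<Rightarrow> real \<Rightarrow> real" where
  "net_welfare \<alpha> \<beta> e1 e3 N \<theta> y =
    (let T = default_pay \<alpha> \<beta> e1 y in (1 - \<theta>) * T + max 0 (e3 + \<theta> * T - N))"

lemma utility_welfare_net:
  assumes "splits t \<theta>" "0 \<le> e1" "0 \<le> e3" "0 < N" "\<alpha> \<in> {0..1}" "\<beta> \<in> {0..1}"
    and y: "max_solution \<alpha> \<beta> e1 e3 N \<theta> y"
  shows "utility \<alpha> \<beta> (net e1 e3 N) (prof t) 1 = 0"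
    and "welfare \<alpha> \<beta> (net e1 e3 N) (prof t) = net_welfare \<alpha> \<beta> e1 e3 N \<theta> y"
    and "0 \<le> net_welfare \<alpha> \<beta> e1 e3 N \<theta> y"
proof -
  have y': "0 \<le> y" "y \<le> N"
    using y by (auto simp: max_solution_def Let_def)
  have th: "\<theta> \<le> 1"
    using assms(1) by (auto simp: splits_def)
  have T: "0 \<le> default_pay \<alpha> \<beta> e1 y"
    using assms y' by (simp add: default_pay_def)
  note E = equity_net[OF assms(2,4) y' T th, of e3] and p = clearing_payments_net[OF assms]
  show "utility \<alpha> \<beta> (net e1 e3 N) (prof t) 1 = 0"
    unfolding utility_def p E ..
  show "welfare \<alpha> \<beta> (net e1 e3 N) (prof t) = net_welfare \<alpha> \<beta> e1 e3 N \<theta> y"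
    unfolding welfare_def social_welfare_def p nfirms_net sum_less_4 E net_welfare_def Let_def
    by simp
  show "0 \<le> net_welfare \<alpha> \<beta> e1 e3 N \<theta> y"
    using T th by (simp add: net_welfare_def Let_def)
qed

text \<open>The condition \<open>0 \<le> x\<close> matters for \<open>y = 0\<close>: a negative
  numerator would have ratio infinity there, above the ratio 1 of numerator 0.\<close>

lemma welfare_ratio_mono: "0 \<le> x \<Longrightarrow> x \<le> x' \<Longrightarrow> 0 \<le> y \<Longrightarrow> welfare_ratio x y \<le> welfare_ratio x' y"
  by (auto simp: welfare_ratio_def divide_right_mono)

lemma prof_in_profiles:
  assumes "0 \<le> e1" "0 < N" "t = [{2}, {3}] \<or> t = [{3}, {2}]"
  shows "prof t \<in> profiles (net e1 e3 N)"
  unfolding profiles_def mem_Collect_eq nfirms_net all_less_4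
  using assms
  by (auto simp: prof_def creditors_net strategies_empty strategies_singleton strategies_def
      partition_on_def disjoint_def)

text \<open>Firm 1 has utility 0 under each of its three strategies and every other firm has a
  single strategy, so no deviation helps. A solution for \<open>\<theta> = 1 / 2\<close> is required
  because a deviation of firm 1 to the tie must be evaluated too.\<close>

lemma nash_net:
  assumes "0 \<le> e1" "0 \<le> e3" "0 < N" "\<alpha> \<in> {0..1}" "\<beta> \<in> {0..1}"
    and t: "t = [{2}, {3}] \<or> t = [{3}, {2}]"
    and ex: "\<And>\<theta>. \<theta> \<in> {0, 1 / 2, 1} \<Longrightarrow> \<exists>y. max_solution \<alpha> \<beta> e1 e3 N \<theta> y"
  shows "prof t \<in> nash_equilibria \<alpha> \<beta> (net e1 e3 N)"
proof -
  have util: "utility \<alpha> \<beta> (net e1 e3 N) (prof t') 1 = 0" if "splits t' \<theta>" for t' \<theta>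
  proof -
    have "\<theta> \<in> {0, 1 / 2, 1}"
      using that by (auto simp: splits_def)
    then show ?thesis
      using ex utility_welfare_net(1)[OF that assms(1-5)] by blast
  qed
  have "utility \<alpha> \<beta> (net e1 e3 N) ((prof t)(i := t')) i \<le> utility \<alpha> \<beta> (net e1 e3 N) (prof t) i"
    if i: "i < 4" and t': "t' \<in> strategies (net e1 e3 N) i" for i t'
  proof (cases "i = 1")
    case True
    have "creditors (net e1 e3 N) 1 = {2, 3}"
      using assms(1,3) by (simp add: creditors_net)
    from strategies_pair[OF this t'[unfolded True]] obtain \<theta>' where "splits t' \<theta>'"
      unfolding splits_def by metis
    moreover obtain \<theta> where "splits t \<theta>"
      using t unfolding splits_def by metis
    moreover have "(prof t)(i := t') = prof t'"
      using True by (auto simp: prof_def)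
    ultimately show ?thesis
      using util True by simp
  next
    case False
    then have "t' = prof t i"
      using t' assms(1,3)
      by (auto simp: prof_def creditors_net strategies_empty strategies_singleton split: if_splits)
    then show ?thesis
      by simp
  qed
  then show ?thesis
    using prof_in_profiles[OF assms(1,3) t] by (simp add: nash_equilibria_def)
qed

text \<open>The split \<theta> plays the role of the equilibrium, while \<theta>' supplies a lower
  bound for the optimum.\<close>

lemma poa_net_ge:
  assumes "0 \<le> e1" "0 \<le> e3" "0 < N" "\<alpha> \<in> {0..1}" "\<beta> \<in> {0..1}"
    and ex: "\<And>\<theta>. \<theta> \<in> {0, 1 / 2, 1} \<Longrightarrow> max_solution \<alpha> \<beta> e1 e3 N \<theta> (y \<theta>)"
    and th: "\<theta> \<in> {0, 1}" "\<theta>' \<in> {0, 1}"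
  shows "welfare_ratio (net_welfare \<alpha> \<beta> e1 e3 N \<theta>' (y \<theta>')) (net_welfare \<alpha> \<beta> e1 e3 N \<theta> (y \<theta>))
    \<le> poa \<alpha> \<beta> (net e1 e3 N)"
proof -
  let ?G = "net e1 e3 N"
  have "\<exists>t. (t = [{2}, {3}] \<or> t = [{3}, {2}]) \<and> splits t \<theta>"
    if "\<theta> \<in> {0, 1}" for \<theta>
    using that by (auto simp: splits_def)
  then obtain t t' where t: "t = [{2}, {3}] \<or> t = [{3}, {2}]" "splits t \<theta>"
    and t': "t' = [{2}, {3}] \<or> t' = [{3}, {2}]" "splits t' \<theta>'"
    using th by meson
  have y: "max_solution \<alpha> \<beta> e1 e3 N \<theta> (y \<theta>)" "max_solution \<alpha> \<beta> e1 e3 N \<theta>' (y \<theta>')"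
    using ex th by auto
  note u = utility_welfare_net[OF t(2) assms(1-5) y(1)]
  note u' = utility_welfare_net[OF t'(2) assms(1-5) y(2)]
  have "welfare \<alpha> \<beta> ?G (prof t') \<le> opt \<alpha> \<beta> ?G"
    unfolding opt_def using prof_in_profiles[OF assms(1,3) t'(1)] finite_profiles
    by (intro Max_ge) auto
  then have "welfare_ratio (net_welfare \<alpha> \<beta> e1 e3 N \<theta>' (y \<theta>')) (net_welfare \<alpha> \<beta> e1 e3 N \<theta> (y \<theta>))
      \<le> welfare_ratio (opt \<alpha> \<beta> ?G) (welfare \<alpha> \<beta> ?G (prof t))"
    unfolding u(2) u'(2) by (intro welfare_ratio_mono u(3) u'(3))
  also have "\<dots> \<le> poa \<alpha> \<beta> ?G"
    unfolding poa_def using nash_net[OF assms(1-5) t(1)] ex by (intro SUP_upper) blast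
  finally show ?thesis .
qed

section \<open>The two instances\<close>

text \<open>The debt of firm 3 is so large that it defaults whatever firm 1 does. If firm 1 prefers
  firm 3, nobody has positive equity; if it prefers firm 2, welfare is
  \<open>\<alpha> + \<beta>\<close>, which is positive. The ratio is therefore infinite.\<close>

lemma poa_infinite_net:
  assumes "\<alpha> \<in> {0..1}" "0 \<le> \<beta>" "\<beta> < 1" "0 < \<alpha> + \<beta>"
  shows "poa \<alpha> \<beta> (net 1 0 (3 / (1 - \<beta>))) = \<infinity>"
proof -
  define N where "N = 3 / (1 - \<beta>)"
  \<comment> \<open>The solution of the linear equation
    \<open>y = \<beta> * \<theta> * (\<alpha> + \<beta> * (1 + y))\<close> of firm 3 in
    default.\<close>
  define y where "y \<theta> = \<beta> * \<theta> * (\<alpha> + \<beta>) / (1 - \<beta> * \<beta> * \<theta>)" for \<theta>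
  have "1 - \<beta> \<noteq> 0"
    using assms(3) by simp
  then have N: "0 < N" "N * (1 - \<beta>) = 3"
    unfolding N_def using assms(3) by (simp, metis nonzero_divide_eq_eq)
  \<comment> \<open>Firm 1 pays at most \<open>\<alpha> + \<beta> + \<beta> * N\<close>. By the
    choice of \<open>N\<close>, the product \<open>\<beta> * N\<close> is \<open>N - 3\<close>, and
    \<open>\<alpha> + \<beta>\<close> is below 3.\<close>
  have default: "\<theta> * default_pay \<alpha> \<beta> 1 z < N"
    if "0 \<le> \<theta>" "\<theta> \<le> 1" "0 \<le> z" "z \<le> N" for \<theta> z
  proof -
    have "\<beta> * z \<le> \<beta> * N"
      using that assms by (intro mult_left_mono) auto
    moreover have "\<beta> * N = N - 3"
      using N(2) by (simp add: algebra_simps)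
    ultimately have "default_pay \<alpha> \<beta> 1 z < N"
      using assms by (auto simp: default_pay_def algebra_simps)
    moreover have "0 \<le> default_pay \<alpha> \<beta> 1 z"
      using assms that by (simp add: default_pay_def)
    then have "\<theta> * default_pay \<alpha> \<beta> 1 z \<le> default_pay \<alpha> \<beta> 1 z"
      using that by (simp add: mult_left_le_one_le)
    ultimately show ?thesis by simp
  qed
  have sol: "max_solution \<alpha> \<beta> 1 0 N \<theta> (y \<theta>)" if th: "0 \<le> \<theta>" "\<theta> \<le> 1" for \<theta>
  proof -
    have "\<beta> * (\<beta> * \<theta>) \<le> \<beta> * 1"
      using th assms by (intro mult_left_mono mult_le_one) auto
    then have den: "1 - \<beta> \<le> 1 - \<beta> * \<beta> * \<theta>"
      by (simp add: mult.assoc)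
    then have pos: "0 < 1 - \<beta> * \<beta> * \<theta>"
      using assms by simp
    have iff: "z = 0 + \<beta> * (\<theta> * default_pay \<alpha> \<beta> 1 z) \<longleftrightarrow> z = y \<theta>" for z
      using pos by (auto simp: y_def default_pay_def field_simps)
    have "\<beta> * \<theta> * (\<alpha> + \<beta>) \<le> 1 * (\<alpha> + \<beta>)"
      using th assms by (intro mult_right_mono mult_le_one) auto
    also have "\<dots> \<le> 3"
      using assms by simp
    finally have "y \<theta> \<le> N"
      unfolding y_def N_def using den assms by (intro frac_le) auto
    moreover have "0 \<le> y \<theta>"
      unfolding y_def using pos th assms by (intro divide_nonneg_pos) auto
    ultimately have "0 \<le> z \<and> z \<le> N \<and> z = (if N \<le> 0 + \<theta> * default_pay \<alpha> \<beta> 1 z then N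
        else \<alpha> * 0 + \<beta> * (\<theta> * default_pay \<alpha> \<beta> 1 z)) \<longleftrightarrow> z = y \<theta>" for z
    proof (cases "0 \<le> z \<and> z \<le> N")
      case True
      then show ?thesis
        using default[OF th, of z] iff[of z] by simp
    qed auto
    then show ?thesis
      unfolding max_solution_def Let_def by simp
  qed
  have "0 < net_welfare \<alpha> \<beta> 1 0 N 0 (y 0)"
    using assms N by (simp add: net_welfare_def Let_def default_pay_def y_def)
  moreover have "net_welfare \<alpha> \<beta> 1 0 N 1 (y 1) = 0"
    using default[of 1 "y 1"] sol[of 1]
    by (auto simp: net_welfare_def Let_def max_solution_def)
  moreover have "welfare_ratio (net_welfare \<alpha> \<beta> 1 0 N 0 (y 0)) (net_welfare \<alpha> \<beta> 1 0 N 1 (y 1))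
    \<le> poa \<alpha> \<beta> (net 1 0 N)"
    using assms N sol by (intro poa_net_ge) auto
  ultimately show ?thesis
    by (simp add: welfare_ratio_def N_def)
qed

text \<open>If firm 1 prefers firm 2, then firm 3 defaults and only \<open>\<alpha> * M\<close> of
  its assets survives, giving welfare \<open>1 + \<alpha> * M\<close>. If it prefers firm 3, then
  firm 3 pays \<open>M + 1\<close>, all of which returns together with the unit of firm 0, so
  nothing is lost and welfare is \<open>1 + M\<close>.\<close>

lemma poa_net_full_recovery:
  assumes "0 \<le> \<alpha>" "\<alpha> < 1" "0 < M"
  shows "ereal ((1 + M) / (1 + \<alpha> * M)) \<le> poa \<alpha> 1 (net 0 M (M + 1))"
proof -
  \<comment> \<open>For \<theta> equal to 1/2 or 1 firm 3 can be solvent, and its full debt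
    \<open>M + 1\<close> is trivially the largest solution. At \<open>\<theta> = 1 / 2\<close> it
    receives \<open>(M + 2) / 2\<close>, which is more than the missing 1.\<close>
  define y where "y \<theta> = (if \<theta> = 0 then \<alpha> * M else M + 1)" for \<theta> :: real
  have "\<alpha> * M \<le> M"
    using assms by (simp add: mult_left_le_one_le)
  then have "\<alpha> * M \<le> M + 1"
    by simp
  then have sol: "max_solution \<alpha> 1 0 M (M + 1) \<theta> (y \<theta>)" if "\<theta> \<in> {0, 1 / 2, 1}" for \<theta>
  proof -
    consider "\<theta> = 0" | "\<theta> = 1 / 2" | "\<theta> = 1"
      using \<open>\<theta> \<in> {0, 1 / 2, 1}\<close> by blast
    then show ?thesis
      using \<open>\<alpha> * M \<le> M + 1\<close> assms
    proof cases
      case 2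
      show ?thesis
        unfolding 2 using assms by (simp add: max_solution_def Let_def default_pay_def y_def)
    qed (simp_all add: max_solution_def Let_def default_pay_def y_def)
  qed
  have "welfare_ratio (net_welfare \<alpha> 1 0 M (M + 1) 1 (y 1)) (net_welfare \<alpha> 1 0 M (M + 1) 0 (y 0))
    \<le> poa \<alpha> 1 (net 0 M (M + 1))"
    using assms sol by (intro poa_net_ge) auto
  moreover have "net_welfare \<alpha> 1 0 M (M + 1) 1 (y 1) = 1 + M"
    using assms by (simp add: net_welfare_def Let_def default_pay_def y_def)
  moreover have "net_welfare \<alpha> 1 0 M (M + 1) 0 (y 0) = 1 + \<alpha> * M"
    using assms by (simp add: net_welfare_def Let_def default_pay_def y_def)
  moreover have "1 + \<alpha> * M \<noteq> 0"
    using assms by (smt (verit) mult_nonneg_nonneg)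
  ultimately show ?thesis
    by (simp add: welfare_ratio_def)
qed

theorem theorem14:
  fixes \<alpha> \<beta> :: real
  assumes "\<alpha> \<in> {0..1}" and "\<beta> \<in> {0..1}"
  shows "(\<alpha> = 0 \<and> \<beta> = 0 \<longrightarrow> class_poa \<alpha> \<beta> = 1)
    \<and> (\<beta> \<in> {0<..<1} \<or> \<beta> = 0 \<and> \<alpha> \<in> {0<..1} \<or> \<beta> = 1 \<and> \<alpha> = 0 \<longrightarrow>
        (\<forall>R::real. 0 < R \<longrightarrow> (\<exists>G::network. valid_network G \<and> ereal R \<le> poa \<alpha> \<beta> G)))
    \<and> (\<beta> = 1 \<and> \<alpha> \<in> {0<..<1} \<longrightarrow>
        (\<forall>\<epsilon>::real. 0 < \<epsilon> \<longrightarrow> ereal (1 / \<alpha> - \<epsilon>) \<le> class_poa \<alpha> \<beta>))"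
proof (intro conjI impI allI)
  assume "\<alpha> = 0 \<and> \<beta> = 0"
  then have "class_poa \<alpha> \<beta> = (SUP G\<in>{G. valid_network G}. 1)"
    unfolding class_poa_def by (intro SUP_cong) (auto simp: poa_no_recovery)
  moreover have "{G. valid_network G} \<noteq> {}"
    \<comment> \<open>Some valid network is needed for the supremum of the constant 1 to be
      1.\<close>
    using valid_net[of 0 0 0] by auto
  ultimately show "class_poa \<alpha> \<beta> = 1"
    by simp
next
  fix R :: real
  assume *: "\<beta> \<in> {0<..<1} \<or> \<beta> = 0 \<and> \<alpha> \<in> {0<..1} \<or> \<beta> = 1 \<and> \<alpha> = 0" and R: "0 < R"
  show "\<exists>G. valid_network G \<and> ereal R \<le> poa \<alpha> \<beta> G"
  proof (cases "\<beta> = 1")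
    case True
    \<comment> \<open>Here \<alpha> is 0, so the bound \<open>(1 + M) / (1 + \<alpha> * M)\<close>
      with \<open>M = R\<close> equals \<open>1 + R\<close>.\<close>
    then have "ereal R \<le> poa \<alpha> \<beta> (net 0 R (R + 1))"
      using * R poa_net_full_recovery[of 0 R] by (auto intro: order.trans[rotated])
    then show ?thesis
      using valid_net[of 0 R "R + 1"] R by auto
  next
    case False
    then have "poa \<alpha> \<beta> (net 1 0 (3 / (1 - \<beta>))) = \<infinity>"
      using * assms by (intro poa_infinite_net) auto
    moreover have "valid_network (net 1 0 (3 / (1 - \<beta>)))"
      using assms by (intro valid_net) auto
    ultimately show ?thesis
      by (intro exI) auto
  qed
next
  fix \<epsilon> :: real
  assume *: "\<beta> = 1 \<and> \<alpha> \<in> {0<..<1}" and \<epsilon>: "0 < \<epsilon>"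
  \<comment> \<open>The gap between \<open>1 / \<alpha>\<close> and
    \<open>(1 + M) / (1 + \<alpha> * M)\<close> is
    \<open>(1 - \<alpha>) / (\<alpha> * (1 + \<alpha> * M))\<close>. This choice makes
    \<open>\<alpha> * (\<alpha> * M) * \<epsilon>\<close> equal to 1, which pushes the gap below
    \<epsilon>.\<close>
  define M where "M = 1 / (\<alpha>\<^sup>2 * \<epsilon>)"
  have a: "0 < \<alpha>" "\<alpha> < 1" and M: "0 < M"
    using * \<epsilon> by (auto simp: M_def)
  have pos: "0 < 1 + \<alpha> * M"
    using a M by (simp add: add_pos_pos)
  have "\<alpha> * (\<alpha> * M) * \<epsilon> = 1"
    using a \<epsilon> by (simp add: M_def power2_eq_square)
  moreover have "0 < \<alpha> * \<epsilon>"
    using a \<epsilon> by simp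
  ultimately have "1 - \<alpha> \<le> \<alpha> * (1 + \<alpha> * M) * \<epsilon>"
    using a by (simp add: algebra_simps)
  then have "1 + \<alpha> * M \<le> (\<epsilon> * (1 + \<alpha> * M) + (1 + M)) * \<alpha>"
    by (simp add: algebra_simps)
  then have "1 / \<alpha> - \<epsilon> \<le> (1 + M) / (1 + \<alpha> * M)"
    using a pos by (simp add: field_simps)
  then have "ereal (1 / \<alpha> - \<epsilon>) \<le> ereal ((1 + M) / (1 + \<alpha> * M))"
    by simp
  also have "\<dots> \<le> poa \<alpha> \<beta> (net 0 M (M + 1))"
    using * poa_net_full_recovery[of \<alpha> M] a M by simp
  also have "\<dots> \<le> class_poa \<alpha> \<beta>"
    unfolding class_poa_def using M by (intro SUP_upper) (simp add: valid_net)
  finally show "ereal (1 / \<alpha> - \<epsilon>) \<le> class_poa \<alpha> \<beta>" .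
qed

end
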